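(* Consider the multiple-group random coefficient regression model with $s$ groups, group sizes $n_i$, numbers of observations per unit $m_i$, regression matrices $\mathbf{G}_i$ on experimental regions $\mathcal{X}_i$, random-effects covariance matrices $\mathbf{D}_i$ and error covariance matrices $\mathbf{\Sigma}_i$, $i=1,\dots,s$, and let $\mathbf{V}=\mathbf{L}^\top\mathbf{L}$ for a real matrix $\mathbf{L}$ with $p$ columns. Let $\boldsymbol{\xi}^*=(\xi_1^*,\dots,\xi_s^* )$ be approximate designs with all $\mathbf{M}_i(\xi_i^* )$ non-singular, and abbreviate $$\mathbf{A}_i=\left(\mathbf{M}_i(\xi_i^* )^{-1}+\mathbf{\Delta}_i\right)^{-1},\qquad \mathbf{C}=\Big[\sum_{r=1}^s n_rm_r\left(\mathbf{M}_r(\xi_r^* )^{-1}+\mathbf{\Delta}_r\right)^{-1}\Big]^{-1}.$$ Then $\boldsymbol{\xi}^*$ is $L$-optimal for estimation of the mean parameters $\boldsymbol{\beta}_0$ if and only if $$\mathrm{tr}\left\{\tilde{\mathbf{G}}_i(x_i)\left[\mathbf{M}_i(\xi_i^* )^{-1}\mathbf{A}_i\,\mathbf{C}\,\mathbf{V}\,\mathbf{C}\,\mathbf{A}_i\,\mathbf{M}_i(\xi_i^* )^{-1}\right]\tilde{\mathbf{G}}_i(x_i)^\top\right\}\ \le\ \mathrm{tr}\left\{\mathbf{M}_i(\xi_i^* )^{-1}\mathbf{A}_i\,\mathbf{C}\,\mathbf{V}\,\mathbf{C}\,\mathbf{A}_i\right\}$$ for all $x_i\in\mathcal{X}_i$ and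 all $i=1,\dots,s$. Moreover, if $\boldsymbol{\xi}^*$ is $L$-optimal, then for every $i$ equality holds in this inequality at every support point $x_i$ of $\xi_i^*$.
   Context: Model: $\mathbf{Y}_{ijh}=\mathbf{G}_i(x_{ih})\boldsymbol{\beta}_{ij}+\boldsymbol{\varepsilon}_{ijh}$, $x_{ih}\in\mathcal{X}_i$, $h=1,\dots,m_i$, $j=1,\dots,n_i$, $i=1,\dots,s$, where $n_i,m_i$ are positive integers, $\mathbf{G}_i(x)$ is a known real $l\times p$ matrix for $x\in\mathcal{X}_i$, the $p$-dimensional random parameters $\boldsymbol{\beta}_{ij}$ have unknown mean $\boldsymbol{\beta}_0$ and given ($p\times p$, positive semi-definite) covariance matrix $\mathbf{D}_i$, the errors $\boldsymbol{\varepsilon}_{ijh}$ have zero mean and non-singular $l\times l$ covariance matrix $\mathbf{\Sigma}_i$, and all random parameters and errors are uncorrelated. An approximate design $\xi_i$ in group $i$ consists of finitely many distinct points $x_{i1},\dots,x_{ik_i}\in\mathcal{X}_i$ with weights $w_{ih}\ge 0$, $\sum_{h=1}^{k_i}w_{ih}=1$; its support points are the points with positive weight. Put $\tilde{\mathbf{G}}_i=\mathbf{\Sigma}_i^{-1/2}\mathbf{G}_i$ (with $\mathbf{\Sigma}_i^{1/2}$ the symmetric positive definite square root), $$\mathbf{M}_i(\xi_i)=\sum_{h=1}^{k_i}w_{ih}\,\tilde{\mathbf{G}}_i(x_{ih})^\top\tilde{\mathbf{G}}_i(x_{ih}),\qquad \mathbf{\Delta}_i=m_i\mathbf{D}_i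 .$$ Only designs with all $\mathbf{M}_i(\xi_i)$ non-singular are considered (so that the best linear unbiased estimator $\hat{\boldsymbol{\beta}}_0$ exists). For these the covariance matrix of $\hat{\boldsymbol{\beta}}_0$ is (extended to approximate designs) $\left[\sum_{i=1}^sn_im_i(\mathbf{M}_i(\xi_i)^{-1}+\mathbf{\Delta}_i)^{-1}\right]^{-1}$, and the $L$-criterion is $$\phi_L(\xi_1,\dots,\xi_s)=\mathrm{tr}\left(\Big[\sum_{i=1}^sn_im_i\left(\mathbf{M}_i(\xi_i)^{-1}+\mathbf{\Delta}_i\right)^{-1}\Big]^{-1}\mathbf{V}\right).$$ $\boldsymbol{\xi}^*$ is $L$-optimal if it minimizes $\phi_L$ among all vectors of approximate designs $(\xi_1,\dots,\xi_s)$ with all $\mathbf{M}_i(\xi_i)$ non-singular. *)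

theory Defs
  imports "HOL-Analysis.Analysis"
begin

definition pos_semidef_mat :: "real^'n^'n \<Rightarrow> bool" where
  "pos_semidef_mat A \<longleftrightarrow> transpose A = A \<and> (\<forall>x. 0 \<le> x \<bullet> (A *v x))"

definition pos_def_mat :: "real^'n^'n \<Rightarrow> bool" where
  "pos_def_mat A \<longleftrightarrow> transpose A = A \<and> (\<forall>x. x \<noteq> 0 \<longrightarrow> 0 < x \<bullet> (A *v x))"

(* Meaningful for symmetric positive definite S, where the root exists and is unique. *)
definition mat_sqrt :: "real^'n^'n \<Rightarrow> real^'n^'n" where
  "mat_sqrt S = (THE R. pos_def_mat R \<and> R ** R = S)"

(* Y_ijh = G_i(x_ih) beta_ij + eps_ijh for i = 1..s, j = 1..n_i, h = 1..m_i, with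
   Cov(beta_ij) = D_i and Cov(eps_ijh) = Sigma_i.  Only the data entering the design problem
   are recorded.  Group-indexed fields matter on {1..s} only; all regions live in one type 'x,
   which may be a disjoint union when the groups are observed on unrelated regions. *)
record ('x, 'p::finite, 'l::finite) rcr_model =
  num_groups :: nat
  group_size :: "nat \<Rightarrow> nat"
  num_obs :: "nat \<Rightarrow> nat"
  region :: "nat \<Rightarrow> 'x set"
  regr_mat :: "nat \<Rightarrow> 'x \<Rightarrow> real^'p^'l"
  param_cov :: "nat \<Rightarrow> real^'p^'p"
  error_cov :: "nat \<Rightarrow> real^'l^'l"

definition groups :: "('x, 'p::finite, 'l::finite) rcr_model \<Rightarrow> nat set" where
  "groups \<M> = {1..num_groups \<M>}"

definition valid_model :: "('x, 'p::finite, 'l::finite) rcr_model \<Rightarrow> bool" where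
  "valid_model \<M> \<longleftrightarrow> num_groups \<M> \<ge> 1 \<and>
     (\<forall>i\<in>groups \<M>. group_size \<M> i \<ge> 1 \<and> num_obs \<M> i \<ge> 1 \<and>
        pos_semidef_mat (param_cov \<M> i) \<and>
        pos_semidef_mat (error_cov \<M> i) \<and> invertible (error_cov \<M> i))"

(* Points of weight zero are allowed, so the support may be smaller than the set of points;
   the values of the weight function outside the set of points are irrelevant. *)
record 'x design =
  design_points :: "'x set"
  design_weight :: "'x \<Rightarrow> real"

definition approx_design_on :: "'x set \<Rightarrow> 'x design \<Rightarrow> bool" where
  "approx_design_on X \<xi> \<longleftrightarrow> finite (design_points \<xi>) \<and> design_points \<xi> \<subseteq> X \<and>
     (\<forall>x\<in>design_points \<xi>. 0 \<le> design_weight \<xi> x) \<and>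
     (\<Sum>x\<in>design_points \<xi>. design_weight \<xi> x) = 1"

definition design_support :: "'x design \<Rightarrow> 'x set" where
  "design_support \<xi> = {x \<in> design_points \<xi>. 0 < design_weight \<xi> x}"

definition std_regr_mat :: "('x, 'p::finite, 'l::finite) rcr_model \<Rightarrow> nat \<Rightarrow> 'x \<Rightarrow> real^'p^'l" where
  "std_regr_mat \<M> i x = matrix_inv (mat_sqrt (error_cov \<M> i)) ** regr_mat \<M> i x"

definition info_mat :: "('x, 'p::finite, 'l::finite) rcr_model \<Rightarrow> nat \<Rightarrow> 'x design \<Rightarrow> real^'p^'p" where
  "info_mat \<M> i \<xi> = (\<Sum>x\<in>design_points \<xi>. design_weight \<xi> x *\<^sub>R
     (transpose (std_regr_mat \<M> i x) ** std_regr_mat \<M> i x))"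

definition scaled_param_cov :: "('x, 'p::finite, 'l::finite) rcr_model \<Rightarrow> nat \<Rightarrow> real^'p^'p" where
  "scaled_param_cov \<M> i = real (num_obs \<M> i) *\<^sub>R param_cov \<M> i"

definition group_info :: "('x, 'p::finite, 'l::finite) rcr_model \<Rightarrow> (nat \<Rightarrow> 'x design) \<Rightarrow> nat \<Rightarrow> real^'p^'p" where
  "group_info \<M> \<xi> i =
     matrix_inv (matrix_inv (info_mat \<M> i (\<xi> i)) + scaled_param_cov \<M> i)"

(* For an exact design with m_i observations per unit this is the covariance matrix of the best
   linear unbiased estimator of the common mean of the beta_ij; the formula extends it to
   approximate designs. *)
definition estimator_cov :: "('x, 'p::finite, 'l::finite) rcr_model \<Rightarrow> (nat \<Rightarrow> 'x design) \<Rightarrow> real^'p^'p" where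
  "estimator_cov \<M> \<xi> = matrix_inv
     (\<Sum>r\<in>groups \<M>. (real (group_size \<M> r) * real (num_obs \<M> r)) *\<^sub>R group_info \<M> \<xi> r)"

definition admissible_designs :: "('x, 'p::finite, 'l::finite) rcr_model \<Rightarrow> (nat \<Rightarrow> 'x design) \<Rightarrow> bool" where
  "admissible_designs \<M> \<xi> \<longleftrightarrow> (\<forall>i\<in>groups \<M>.
     approx_design_on (region \<M> i) (\<xi> i) \<and> invertible (info_mat \<M> i (\<xi> i)))"

definition L_criterion ::
    "('x, 'p::finite, 'l::finite) rcr_model \<Rightarrow> real^'p^'p \<Rightarrow> (nat \<Rightarrow> 'x design) \<Rightarrow> real" where
  "L_criterion \<M> V \<xi> = trace (estimator_cov \<M> \<xi> ** V)"

definition L_optimal ::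
    "('x, 'p::finite, 'l::finite) rcr_model \<Rightarrow> real^'p^'p \<Rightarrow> (nat \<Rightarrow> 'x design) \<Rightarrow> bool" where
  "L_optimal \<M> V \<xi> \<longleftrightarrow> admissible_designs \<M> \<xi> \<and>
     (\<forall>\<eta>. admissible_designs \<M> \<eta> \<longrightarrow> L_criterion \<M> V \<xi> \<le> L_criterion \<M> V \<eta>)"

end

theory Submission
  imports Defs
begin

text \<open>
  The criterion is convex in the information matrices, and the proof uses this only through an
  affine lower bound: for all admissible \<open>\<xi>\<close>, \<open>\<eta>\<close> with information matrices \<open>M\<^sub>i\<close>, \<open>N\<^sub>i\<close>,
  \<open>\<phi>(\<eta>) \<ge> \<phi>(\<xi>) + \<Sum>\<^sub>i n\<^sub>i m\<^sub>i tr (B\<^sub>i(\<xi>) (M\<^sub>i - N\<^sub>i))\<close>, where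
  \<open>B\<^sub>i = M\<^sub>i\<inverse> A\<^sub>i C V C A\<^sub>i M\<^sub>i\<inverse>\<close>. The left-hand side of the optimality condition averages to
  \<open>tr (B\<^sub>i N\<^sub>i)\<close> over a design with information matrix \<open>N\<^sub>i\<close>, and its right-hand side is
  \<open>tr (B\<^sub>i M\<^sub>i)\<close>. Hence sufficiency is immediate, and so is equality on the support once
  necessity is known. For necessity no derivative is needed: the bound taken at the design
  \<open>\<eta>\<^sub>t\<close> that moves mass \<open>t\<close> to a point \<open>x\<close> in group \<open>i\<close>, and evaluated at an optimal \<open>\<xi>\<close>, gives
  the condition with \<open>B\<^sub>i(\<eta>\<^sub>t)\<close> in place of \<open>B\<^sub>i(\<xi>)\<close>, and one lets \<open>t\<close> tend to 0.
\<close>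

section \<open>Matrix algebra and continuity of the inverse\<close>

text \<open>One source for both the algebra and the limits: the interpretation below yields
  distributivity, scaling, sums and convergence of rectangular products.\<close>

lemma bounded_bilinear_matrix_matrix_mult:
  "bounded_bilinear ((**) :: real^'n^'m \<Rightarrow> real^'k^'n \<Rightarrow> real^'k^'m)"
  unfolding bilinear_conv_bounded_bilinear[symmetric] bilinear_def linear_iff
  by (auto simp: vec_eq_iff matrix_matrix_mult_def sum.distrib algebra_simps sum_distrib_left)

interpretation matrix_mult: bounded_bilinear "(**) :: real^'n^'m \<Rightarrow> real^'k^'n \<Rightarrow> real^'k^'m"
  by (rule bounded_bilinear_matrix_matrix_mult)

lemma linear_transpose: "linear (transpose :: real^'n^'m \<Rightarrow> real^'m^'n)"
  by (auto simp: linear_iff vec_eq_iff transpose_def)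

lemmas transpose_add = linear_add[OF linear_transpose]
  and transpose_diff = linear_diff[OF linear_transpose]
  and transpose_zero = linear_0[OF linear_transpose]

lemma linear_trace: "linear (trace :: real^'n^'n \<Rightarrow> real)"
  by (auto simp: linear_iff trace_def sum.distrib sum_distrib_left)

lemmas trace_sum = linear_sum[OF linear_trace]
  and trace_scaleR = linear_cmul[OF linear_trace]

lemma matrix_inv_mult:
  fixes A :: "real^'n^'n"
  assumes "invertible A"
  shows "A ** matrix_inv A = mat 1" "matrix_inv A ** A = mat 1"
  using someI_ex[OF assms[unfolded invertible_def]] by (auto simp: matrix_inv_def)

text \<open>Column \<open>l\<close> of the inverse solves \<open>A *v x = axis l 1\<close>, so
  Cramer's rule applies. The inverse becomes a quotient of determinants, whose continuity is
  plain.\<close>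

lemma matrix_inv_nth:
  fixes A :: "real^'n^'n"
  assumes "invertible A"
  shows "matrix_inv A $ k $ l =
    det (\<chi> i j. if j = k then mat 1 $ i $ l else A $ i $ j) / det A"
proof -
  have "A *v column l (matrix_inv A) = column l (mat 1)"
    unfolding matrix_inv_mult(1)[OF assms, symmetric]
    by (simp add: vec_eq_iff column_def matrix_vector_mult_def matrix_matrix_mult_def)
  then have "column l (matrix_inv A) =
      (\<chi> k. det (\<chi> i j. if j = k then column l (mat 1) $ i else A $ i $ j) / det A)"
    using assms by (simp add: cramer invertible_det_nz)
  from arg_cong[OF this, of "\<lambda>v. v $ k"] show ?thesis
    by (simp add: column_def cong: if_cong)
qed

lemma tendsto_det:
  fixes P :: "'a \<Rightarrow> real^'n^'n"
  assumes "(P \<longlongrightarrow> Q) F"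
  shows "((\<lambda>x. det (P x)) \<longlongrightarrow> det Q) F"
  unfolding det_def by (intro tendsto_intros assms)

lemma tendsto_matrix_inv:
  fixes P :: "'a \<Rightarrow> real^'n^'n"
  assumes lim: "(P \<longlongrightarrow> Q) F" and Q: "invertible Q"
  shows "((\<lambda>x. matrix_inv (P x)) \<longlongrightarrow> matrix_inv Q) F"
proof (intro vec_tendstoI)
  fix k l :: 'n
  \<comment> \<open>Invertibility is assumed of the limit alone; it passes to \<open>P x\<close>
    eventually, which is enough to use Cramer's formula under the limit.\<close>
  have ev: "\<forall>\<^sub>F x in F. det (P x) \<noteq> 0"
    using tendsto_imp_eventually_ne[OF tendsto_det[OF lim]] Q by (simp add: invertible_det_nz)
  have "((\<lambda>x. det (\<chi> i j. if j = k then mat 1 $ i $ l else P x $ i $ j) / det (P x)) \<longlongrightarrow>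
      det (\<chi> i j. if j = k then mat 1 $ i $ l else Q $ i $ j) / det Q) F"
    using Q by (intro tendsto_divide tendsto_det lim tendsto_vec_lambda)
      (auto simp: invertible_det_nz intro!: tendsto_const tendsto_vec_nth lim)
  then show "((\<lambda>x. matrix_inv (P x) $ k $ l) \<longlongrightarrow> matrix_inv Q $ k $ l) F"
    unfolding matrix_inv_nth[OF Q]
    by (rule Lim_transform_eventually)
      (use ev in eventually_elim, simp add: matrix_inv_nth invertible_det_nz)
qed

lemma transpose_matrix_inv:
  fixes A :: "real^'n^'n"
  assumes "invertible A"
  shows "transpose (matrix_inv A) = matrix_inv (transpose A)"
proof -
  have "transpose (matrix_inv A) ** transpose A = mat 1"
    by (simp add: matrix_transpose_mul[symmetric] matrix_inv_mult assms)
  then have "transpose (matrix_inv A) ** (transpose A ** matrix_inv (transpose A))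
      = matrix_inv (transpose A)"
    by (simp add: matrix_mul_assoc)
  then show ?thesis
    using assms by (simp add: matrix_inv_mult transpose_invertible)
qed

section \<open>Positive definite matrices\<close>

lemma dot_transpose_matrix_vector:
  fixes A :: "real^'n^'m"
  shows "x \<bullet> (transpose A *v y) = (A *v x) \<bullet> y"
  by (metis dot_lmul_matrix inner_commute transpose_matrix_vector)

lemma pos_semidef_add:
  "pos_semidef_mat A \<Longrightarrow> pos_semidef_mat B \<Longrightarrow> pos_semidef_mat (A + B)"
  by (auto simp: pos_semidef_mat_def transpose_add matrix_vector_mult_add_rdistrib inner_add_right)

lemma pos_semidef_scaleR:
  "pos_semidef_mat A \<Longrightarrow> 0 \<le> c \<Longrightarrow> pos_semidef_mat (c *\<^sub>R A)"
  by (auto simp: pos_semidef_mat_def transpose_scalar scaleR_matrix_vector_assoc[symmetric])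

lemma pos_semidef_sum:
  "(\<And>i. i \<in> I \<Longrightarrow> pos_semidef_mat (A i)) \<Longrightarrow> pos_semidef_mat (\<Sum>i\<in>I. A i)"
  by (induction I rule: infinite_finite_induct)
    (auto intro: pos_semidef_add simp: pos_semidef_mat_def[of 0] transpose_zero)

lemma pos_semidef_congruence:
  fixes A :: "real^'n^'n" and X :: "real^'m^'n"
  assumes "pos_semidef_mat A"
  shows "pos_semidef_mat (transpose X ** A ** X)"
  using assms
  by (auto simp: pos_semidef_mat_def matrix_transpose_mul matrix_mul_assoc
      dot_transpose_matrix_vector matrix_vector_mul_assoc[symmetric] simp del: transpose_matrix_vector)

lemma pos_semidef_gram: "pos_semidef_mat (transpose X ** X)" for X :: "real^'m^'n"
  using pos_semidef_congruence[of "mat 1" X] by (simp add: pos_semidef_mat_def)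

lemma pos_def_imp_pos_semidef: "pos_def_mat A \<Longrightarrow> pos_semidef_mat A"
  unfolding pos_def_mat_def pos_semidef_mat_def
  by (metis inner_zero_left less_eq_real_def)

lemma pos_def_add:
  "pos_def_mat A \<Longrightarrow> pos_semidef_mat B \<Longrightarrow> pos_def_mat (A + B)"
  by (auto simp: pos_semidef_mat_def pos_def_mat_def transpose_add
      matrix_vector_mult_add_rdistrib inner_add_right intro!: add_pos_nonneg)

lemma pos_def_scaleR:
  "pos_def_mat A \<Longrightarrow> 0 < c \<Longrightarrow> pos_def_mat (c *\<^sub>R A)"
  by (auto simp: pos_def_mat_def transpose_scalar scaleR_matrix_vector_assoc[symmetric])

lemma pos_def_sum:
  assumes "finite I" "I \<noteq> {}" "\<And>i. i \<in> I \<Longrightarrow> pos_def_mat (A i)"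
  shows "pos_def_mat (\<Sum>i\<in>I. A i)"
proof -
  obtain i where i: "i \<in> I" using assms(2) by blast
  have "pos_def_mat (A i + (\<Sum>i\<in>I - {i}. A i))"
    by (intro pos_def_add pos_semidef_sum) (auto intro: pos_def_imp_pos_semidef assms(3) i)
  then show ?thesis using sum.remove[OF assms(1) i, of A] by simp
qed

lemma pos_def_invertible:
  assumes "pos_def_mat A"
  shows "invertible A"
proof -
  have "x = 0" if "A *v x = 0" for x
    using assms that unfolding pos_def_mat_def by (metis inner_zero_right less_irrefl)
  then show ?thesis
    by (simp add: invertible_left_inverse matrix_left_invertible_ker)
qed

lemma pos_def_matrix_inv:
  assumes "pos_def_mat A"
  shows "pos_def_mat (matrix_inv A)"
proof -
  have inv: "invertible A" by (rule pos_def_invertible[OF assms])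
  have sym: "transpose A = A" using assms by (simp add: pos_def_mat_def)
  have "0 < x \<bullet> (matrix_inv A *v x)" if "x \<noteq> 0" for x
  proof -
    define y where "y = matrix_inv A *v x"
    have x: "A *v y = x"
      by (simp add: y_def matrix_vector_mul_assoc matrix_inv_mult inv)
    then have "y \<noteq> 0" using that by auto
    then have "0 < y \<bullet> (A *v y)" using assms by (simp add: pos_def_mat_def)
    then show ?thesis by (simp add: x inner_commute flip: y_def)
  qed
  then show ?thesis by (simp add: pos_def_mat_def transpose_matrix_inv inv sym)
qed

text \<open>A zero of a nonnegative quadratic form is a minimizer, so the gradient
  \<open>2 A x\<close> vanishes there, and invertibility leaves only \<open>x = 0\<close>.\<close>

lemma pos_semidef_invertible_imp_pos_def:
  assumes psd: "pos_semidef_mat A" and "invertible A"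
  shows "pos_def_mat A"
proof -
  have "x = 0" if x: "x \<bullet> (A *v x) = 0" for x
  proof -
    define y where "y = A *v x"
    \<comment> \<open>\<open>t\<close> is nearly the minimizer of the quadratic form along the line \<open>x + t y\<close>; the added 1
      keeps the denominator positive.\<close>
    define d where "d = y \<bullet> (A *v y) + 1"
    define t where "t = - (y \<bullet> y) / d"
    have "0 \<le> y \<bullet> (A *v y)" using psd by (simp add: pos_semidef_mat_def)
    then have d: "0 < d" by (simp add: d_def)
    have "x \<bullet> (A *v y) = y \<bullet> y"
      using dot_transpose_matrix_vector[of x A y] psd
      by (simp add: y_def pos_semidef_mat_def del: transpose_matrix_vector)
    then have "0 \<le> 2 * t * (y \<bullet> y) + t\<^sup>2 * (y \<bullet> (A *v y))"
      using psd[unfolded pos_semidef_mat_def, THEN conjunct2, rule_format, of "x + t *\<^sub>R y"] x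
      by (simp add: matrix_vector_right_distrib matrix_vector_mult_scaleR inner_add_left
          inner_add_right y_def[symmetric] power2_eq_square algebra_simps)
    also have "\<dots> \<le> 2 * t * (y \<bullet> y) + t\<^sup>2 * d"
      by (simp add: d_def algebra_simps)
    also have "\<dots> = - (y \<bullet> y)\<^sup>2 / d"
      using d unfolding t_def by (simp add: field_simps power2_eq_square)
    finally have "y \<bullet> y = 0" using d by (simp add: divide_simps)
    then show "x = 0"
      using \<open>invertible A\<close> by (simp add: y_def invertible_left_inverse matrix_left_invertible_ker)
  qed
  then show ?thesis
    using psd unfolding pos_def_mat_def pos_semidef_mat_def by (metis less_eq_real_def)
qed

text \<open>By cyclicity the trace is that of \<open>L P L^T\<close>. This is where the form of V
  enters: it turns inequalities between matrices into inequalities between traces against V.\<close>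

lemma trace_pos_semidef_gram_nonneg:
  fixes L :: "real^'n^'m"
  assumes "pos_semidef_mat P"
  shows "0 \<le> trace (P ** (transpose L ** L))"
proof -
  have "trace (P ** (transpose L ** L)) = trace (transpose (transpose L) ** P ** transpose L)"
    using trace_mul_sym[of "P ** transpose L" L] by (simp add: matrix_mul_assoc)
  moreover have "0 \<le> trace B" if "pos_semidef_mat B" for B :: "real^'m^'m"
  proof -
    have "B $ i $ i = axis i 1 \<bullet> (B *v axis i 1)" for i
      by (simp add: matrix_vector_mul_component inner_axis inner_axis')
    then show ?thesis using that by (auto simp: trace_def pos_semidef_mat_def intro!: sum_nonneg)
  qed
  ultimately show ?thesis using pos_semidef_congruence[OF assms, of "transpose L"] by simp
qed

section \<open>The affine lower bound\<close>

text \<open>The difference is the square \<open>(K^-1 - C)^T K (K^-1 - C)\<close>. If C is the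
  inverse of some \<open>K0\<close>, then \<open>2 C - C K C\<close> is the tangent at
  \<open>K0\<close> of the convex map sending K to its inverse.\<close>

lemma matrix_inv_convex:
  fixes K C :: "real^'n^'n"
  assumes "pos_def_mat K" and "transpose C = C"
  shows "pos_semidef_mat (matrix_inv K - (2 *\<^sub>R C - C ** K ** C))"
proof -
  have inv: "matrix_inv K ** K = mat 1" "K ** matrix_inv K = mat 1"
    using pos_def_invertible[OF assms(1)] by (auto simp: matrix_inv_mult)
  then have inv': "C ** K ** matrix_inv K = C"
    by (simp flip: matrix_mul_assoc)
  have "transpose (matrix_inv K - C) = matrix_inv K - C"
    using pos_def_matrix_inv[OF assms(1)] assms(2) by (simp add: transpose_diff pos_def_mat_def)
  then have "matrix_inv K - (2 *\<^sub>R C - C ** K ** C) =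
      transpose (matrix_inv K - C) ** K ** (matrix_inv K - C)"
    by (simp add: matrix_mult.diff_left matrix_mult.diff_right inv inv' scaleR_2)
  then show ?thesis
    using pos_semidef_congruence[OF pos_def_imp_pos_semidef[OF assms(1)]] by metis
qed


text \<open>The parallel-sum principle: for invertible \<open>D\<close>, \<open>(N\<inverse> + D)\<inverse>\<close> is the minimum of
  \<open>X\<^sup>T N X + (1 - X)\<^sup>T D\<inverse> (1 - X)\<close> over \<open>X\<close>. Substituting \<open>X = 1 - D Y\<close> removes the inverse of \<open>D\<close>,
  which may be singular.\<close>

lemma information_le_quadratic:
  fixes N D Y :: "real^'n^'n"
  assumes N: "pos_def_mat N" and D: "pos_semidef_mat D"
  shows "pos_semidef_mat (transpose (mat 1 - D ** Y) ** N ** (mat 1 - D ** Y)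
    + transpose Y ** D ** Y - matrix_inv (matrix_inv N + D))"
proof -
  define W where "W = matrix_inv N"
  define S where "S = matrix_inv (W + D)"
  \<comment> \<open>The minimum is attained at \<open>Y = S\<close>, where X equals
    \<open>W S\<close>. In terms of the deviation E the linear terms cancel, and two positive
    semidefinite quadratic terms remain.\<close>
  define E where "E = Y - S"
  have pd: "pos_def_mat W" "pos_def_mat (W + D)" "pos_def_mat S"
    unfolding S_def W_def by (intro pos_def_add pos_def_matrix_inv N D)+
  have sym: "transpose W = W" "transpose S = S" "transpose D = D"
    using pd D by (auto simp: pos_def_mat_def pos_semidef_mat_def)
  \<comment> \<open>The leading factor Z lets the simplifier cancel inside products nested to the
    left, the normal form under \<open>matrix_mul_assoc\<close>.\<close>
  have WN: "Z ** W ** N = Z" "Z ** N ** W = Z" for Z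
    using matrix_inv_mult[OF pos_def_invertible[OF N]] by (simp_all add: W_def flip: matrix_mul_assoc)
  have S: "W ** S + D ** S = mat 1" "S ** W + S ** D = mat 1"
    using matrix_inv_mult[OF pos_def_invertible[OF pd(2)]]
    by (simp_all add: S_def matrix_mult.add_left matrix_mult.add_right)
  have SS: "S ** W ** S + S ** D ** S = S"
    using arg_cong[OF S(2), of "\<lambda>Z. Z ** S"] by (simp add: matrix_mult.add_left)
  have X: "mat 1 - D ** Y = W ** S - D ** E"
    by (simp add: S(1)[symmetric] E_def matrix_mult.diff_right)
  have "transpose (W ** S - D ** E) = S ** W - transpose E ** D"
    by (simp add: transpose_diff matrix_transpose_mul sym)
  moreover have "transpose Y = S + transpose E" "Y = S + E"
    by (simp_all add: E_def transpose_diff sym)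
  ultimately have "transpose (mat 1 - D ** Y) ** N ** (mat 1 - D ** Y) + transpose Y ** D ** Y
      = S ** W ** S + S ** D ** S + transpose E ** D ** E + transpose E ** D ** N ** D ** E"
    unfolding X by (simp add: matrix_mult.add_left matrix_mult.add_right matrix_mult.diff_left
        matrix_mult.diff_right matrix_mul_assoc WN)
  then have "transpose (mat 1 - D ** Y) ** N ** (mat 1 - D ** Y) + transpose Y ** D ** Y - S
      = transpose E ** D ** E + transpose (D ** E) ** N ** (D ** E)"
    by (simp add: SS matrix_transpose_mul sym matrix_mul_assoc)
  then show ?thesis
    using pos_semidef_add[OF pos_semidef_congruence[OF D]
        pos_semidef_congruence[OF pos_def_imp_pos_semidef[OF N]]]
    by (simp add: S_def W_def)
qed

text \<open>The previous bound is affine in N for fixed Y. Choosing \<open>Y = A\<close>, the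
  minimizer belonging to M, makes it exact at \<open>N = M\<close>, so it is the tangent at M of the
  concave map from N to \<open>(N^-1 + D)^-1\<close>.\<close>

lemma information_concave:
  fixes M N D :: "real^'n^'n"
  assumes M: "pos_def_mat M" and N: "pos_def_mat N" and D: "pos_semidef_mat D"
    and W_def: "W = matrix_inv M" and A_def: "A = matrix_inv (W + D)"
  shows "pos_semidef_mat (A ** W ** (N - M) ** W ** A - (matrix_inv (matrix_inv N + D) - A))"
proof -
  have pd: "pos_def_mat W" "pos_def_mat (W + D)" "pos_def_mat A"
    unfolding A_def W_def by (intro pos_def_add pos_def_matrix_inv M D)+
  have sym: "transpose W = W" "transpose A = A"
    using pd by (auto simp: pos_def_mat_def)
  have WM: "Z ** W ** M = Z" for Z
    using matrix_inv_mult[OF pos_def_invertible[OF M]] by (simp add: W_def flip: matrix_mul_assoc)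
  have A: "W ** A + D ** A = mat 1" "A ** W + A ** D = mat 1"
    using matrix_inv_mult[OF pos_def_invertible[OF pd(2)]]
    by (simp_all add: A_def matrix_mult.add_left matrix_mult.add_right)
  have AA: "A ** W ** A + A ** D ** A = A"
    using arg_cong[OF A(2), of "\<lambda>Z. Z ** A"] by (simp add: matrix_mult.add_left)
  have X: "mat 1 - D ** A = W ** A"
    by (simp add: A(1)[symmetric])
  have "A ** W ** A = A - A ** D ** A"
    using AA by (simp add: eq_diff_eq)
  then have eq: "A ** W ** (N - M) ** W ** A - (matrix_inv (matrix_inv N + D) - A)
      = A ** W ** N ** W ** A + A ** D ** A - matrix_inv (matrix_inv N + D)"
    by (simp add: matrix_mult.diff_left matrix_mult.diff_right WM)
  show ?thesis
    unfolding eq using information_le_quadratic[OF N D, of A]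
    by (simp add: X matrix_transpose_mul sym matrix_mul_assoc)
qed

text \<open>Two tangent bounds are chained: concavity of each group's information, compressed by C
  and traced against V, and then convexity of the inverse of their weighted sum.\<close>

lemma trace_criterion_tangent:
  fixes M N D :: "'i \<Rightarrow> real^'n^'n" and L :: "real^'n^'m"
  assumes I: "finite I" "I \<noteq> {}"
    and c: "\<And>i. i \<in> I \<Longrightarrow> 0 < c i"
    and M: "\<And>i. i \<in> I \<Longrightarrow> pos_def_mat (M i)"
    and N: "\<And>i. i \<in> I \<Longrightarrow> pos_def_mat (N i)"
    and D: "\<And>i. i \<in> I \<Longrightarrow> pos_semidef_mat (D i)"
    and W_def: "\<And>i. W i = matrix_inv (M i)"
    and A_def: "\<And>i. A i = matrix_inv (W i + D i)"
    and C_def: "C = matrix_inv (\<Sum>i\<in>I. c i *\<^sub>R A i)"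
    and V: "V = transpose L ** L"
  shows "trace (C ** V)
      + (\<Sum>i\<in>I. c i * trace (W i ** A i ** C ** V ** C ** A i ** W i ** (M i - N i)))
    \<le> trace (matrix_inv (\<Sum>i\<in>I. c i *\<^sub>R matrix_inv (matrix_inv (N i) + D i)) ** V)"
proof -
  define A' where "A' i = matrix_inv (matrix_inv (N i) + D i)" for i
  define K where "K = (\<Sum>i\<in>I. c i *\<^sub>R A i)"
  define K' where "K' = (\<Sum>i\<in>I. c i *\<^sub>R A' i)"
  have pdK: "pos_def_mat K" "pos_def_mat K'"
    unfolding K_def K'_def A_def A'_def W_def
    by (intro pos_def_sum I pos_def_scaleR c pos_def_matrix_inv pos_def_add M N D; assumption)+
  have symC: "transpose C = C"
    using pos_def_matrix_inv[OF pdK(1)] by (simp add: C_def K_def pos_def_mat_def)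
  have "K ** C = mat 1"
    using matrix_inv_mult(1)[OF pos_def_invertible[OF pdK(1)]] by (simp add: C_def K_def)
  then have CKC: "C ** K ** C = C"
    by (simp flip: matrix_mul_assoc)
  have term_le: "trace (W i ** A i ** C ** V ** C ** A i ** W i ** (M i - N i))
      \<le> trace (C ** (A i - A' i) ** C ** V)" if i: "i \<in> I" for i
  proof -
    let ?P = "A i ** W i ** (N i - M i) ** W i ** A i - (A' i - A i)"
    have "pos_semidef_mat ?P"
      unfolding A'_def by (rule information_concave[OF M[OF i] N[OF i] D[OF i] W_def A_def])
    then have "0 \<le> trace (C ** ?P ** C ** V)"
      using trace_pos_semidef_gram_nonneg[OF pos_semidef_congruence, of ?P C L] by (simp add: symC V)
    \<comment> \<open>Cyclicity puts X between the factors that surround \<open>N i - M i\<close> in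
      \<open>?P\<close>.\<close>
    moreover have "trace (W i ** A i ** C ** V ** C ** A i ** W i ** X)
        = trace (C ** A i ** W i ** X ** W i ** A i ** C ** V)" for X
      using trace_mul_sym[of "W i ** A i ** C ** V" "C ** A i ** W i ** X"]
      by (simp add: matrix_mul_assoc)
    ultimately show ?thesis
      by (simp add: matrix_mult.diff_left matrix_mult.diff_right trace_sub matrix_mul_assoc)
  qed
  have "(\<Sum>i\<in>I. c i * trace (W i ** A i ** C ** V ** C ** A i ** W i ** (M i - N i)))
      \<le> (\<Sum>i\<in>I. c i * trace (C ** (A i - A' i) ** C ** V))"
    using c by (intro sum_mono mult_left_mono term_le) (auto intro: less_imp_le)
  also have "\<dots> = trace (C ** (K - K') ** C ** V)"
    by (simp add: K_def K'_def matrix_mult.sum_left matrix_mult.sum_right matrix_mult.scaleR_left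
        matrix_mult.scaleR_right trace_sum trace_scaleR flip: sum_subtractf scaleR_diff_right)
  also have "\<dots> = trace (C ** V) - trace (C ** K' ** C ** V)"
    by (simp add: matrix_mult.diff_left matrix_mult.diff_right trace_sub CKC)
  \<comment> \<open>This is the tangent bound for the inverse of \<open>K'\<close>, taken at K,
    whose inverse is C.\<close>
  also have "\<dots> \<le> trace (matrix_inv K' ** V) - trace (C ** V)"
    using trace_pos_semidef_gram_nonneg[OF matrix_inv_convex[OF pdK(2) symC], of L]
    by (simp add: V matrix_mult.diff_left matrix_mult.scaleR_left trace_sub trace_scaleR)
  finally show ?thesis by (simp add: K'_def A'_def)
qed

section \<open>Designs\<close>

text \<open>Up to the factor \<open>n_i m_i\<close>, this is the negative gradient of the criterion
  with respect to the information matrix of group i.\<close>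

definition sensitivity_mat ::
    "('x, 'p::finite, 'l::finite) rcr_model \<Rightarrow> real^'p^'p \<Rightarrow> (nat \<Rightarrow> 'x design) \<Rightarrow> nat \<Rightarrow> real^'p^'p" where
  "sensitivity_mat \<M> V \<xi> i = (let W = matrix_inv (info_mat \<M> i (\<xi> i)); A = group_info \<M> \<xi> i;
     C = estimator_cov \<M> \<xi> in W ** A ** C ** V ** C ** A ** W)"

lemma pos_def_info_mat:
  assumes "admissible_designs \<M> \<xi>" "i \<in> groups \<M>"
  shows "pos_def_mat (info_mat \<M> i (\<xi> i))"
proof (rule pos_semidef_invertible_imp_pos_def)
  show "pos_semidef_mat (info_mat \<M> i (\<xi> i))"
    using assms unfolding info_mat_def admissible_designs_def approx_design_on_def
    by (intro pos_semidef_sum pos_semidef_scaleR pos_semidef_gram) auto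
qed (use assms in \<open>auto simp: admissible_designs_def\<close>)

lemma finite_groups [simp]: "finite (groups \<M>)"
  by (simp add: groups_def)

lemma valid_model_groups_nonempty: "valid_model \<M> \<Longrightarrow> groups \<M> \<noteq> {}"
  by (auto simp: valid_model_def groups_def)

lemma pos_semidef_scaled_param_cov:
  "valid_model \<M> \<Longrightarrow> i \<in> groups \<M> \<Longrightarrow> pos_semidef_mat (scaled_param_cov \<M> i)"
  unfolding scaled_param_cov_def valid_model_def by (intro pos_semidef_scaleR) auto

lemma group_weight_pos:
  "valid_model \<M> \<Longrightarrow> i \<in> groups \<M> \<Longrightarrow> 0 < real (group_size \<M> i) * real (num_obs \<M> i)"
  unfolding valid_model_def by (intro mult_pos_pos) force+

lemma pos_def_group_info_inverse:
  assumes "valid_model \<M>" "admissible_designs \<M> \<xi>" "i \<in> groups \<M>"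
  shows "pos_def_mat (matrix_inv (info_mat \<M> i (\<xi> i)) + scaled_param_cov \<M> i)"
  using assms by (intro pos_def_add pos_def_matrix_inv pos_def_info_mat pos_semidef_scaled_param_cov)

lemma pos_def_total_info:
  assumes "valid_model \<M>" "admissible_designs \<M> \<xi>"
  shows "pos_def_mat
    (\<Sum>r\<in>groups \<M>. (real (group_size \<M> r) * real (num_obs \<M> r)) *\<^sub>R group_info \<M> \<xi> r)"
  unfolding group_info_def using assms
  by (intro pos_def_sum pos_def_scaleR pos_def_matrix_inv pos_def_group_info_inverse
      finite_groups valid_model_groups_nonempty group_weight_pos)

lemma L_criterion_tangent:
  fixes L :: "real^'p^'q::finite"
  assumes "valid_model \<M>" "admissible_designs \<M> \<xi>" "admissible_designs \<M> \<eta>"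
    and V: "V = transpose L ** L"
  shows "L_criterion \<M> V \<xi> + (\<Sum>i\<in>groups \<M>. real (group_size \<M> i) * real (num_obs \<M> i) *
      trace (sensitivity_mat \<M> V \<xi> i ** (info_mat \<M> i (\<xi> i) - info_mat \<M> i (\<eta> i))))
    \<le> L_criterion \<M> V \<eta>"
  using assms(1-3)
  unfolding L_criterion_def sensitivity_mat_def Let_def
    estimator_cov_def[of _ \<eta>] group_info_def[of _ \<eta>]
  by (intro trace_criterion_tangent[where D = "scaled_param_cov \<M>", OF finite_groups
        valid_model_groups_nonempty group_weight_pos pos_def_info_mat pos_def_info_mat pos_semidef_scaled_param_cov refl _ _ V])
    (auto simp: estimator_cov_def group_info_def)

lemma trace_mult_info_mat:
  fixes \<M> :: "('x, 'p::finite, 'l::finite) rcr_model"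
  shows
  "trace (B ** info_mat \<M> i \<xi>) = (\<Sum>x\<in>design_points \<xi>. design_weight \<xi> x *
    trace (std_regr_mat \<M> i x ** B ** transpose (std_regr_mat \<M> i x)))"
proof -
  have "trace (B ** (transpose G ** G)) = trace (G ** B ** transpose G)" for G :: "real^'p^'l"
    using trace_mul_sym[of "B ** transpose G" G] by (simp add: matrix_mul_assoc)
  then show ?thesis
    by (simp add: info_mat_def matrix_mult.sum_right matrix_mult.scaleR_right trace_sum trace_scaleR)
qed

text \<open>Weights outside the set of points are arbitrary, so the old weight of \<open>x\<close> may only be counted
  when \<open>x\<close> is already a point.\<close>

definition mix_design :: "real \<Rightarrow> 'x \<Rightarrow> 'x design \<Rightarrow> 'x design" where
  "mix_design t x \<xi> = \<lparr>design_points = insert x (design_points \<xi>),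
     design_weight = (\<lambda>y. (if y \<in> design_points \<xi> then (1 - t) * design_weight \<xi> y else 0)
       + (if y = x then t else 0))\<rparr>"

text \<open>Vector-valued f lets one identity serve twice: constant 1 gives the total weight, and
  the Gram matrices give the information matrix.\<close>

lemma sum_mix_design:
  fixes f :: "'x \<Rightarrow> 'b::real_vector"
  assumes "finite (design_points \<xi>)"
  shows "(\<Sum>y\<in>design_points (mix_design t x \<xi>). design_weight (mix_design t x \<xi>) y *\<^sub>R f y)
    = (1 - t) *\<^sub>R (\<Sum>y\<in>design_points \<xi>. design_weight \<xi> y *\<^sub>R f y) + t *\<^sub>R f x"
proof -
  let ?P = "design_points \<xi>"
  have "(\<Sum>y\<in>insert x ?P. (if y \<in> ?P then (1 - t) * design_weight \<xi> y else 0) *\<^sub>R f y)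
      = (\<Sum>y\<in>?P. (1 - t) *\<^sub>R design_weight \<xi> y *\<^sub>R f y)"
    using assms by (intro sum.mono_neutral_cong_right) auto
  moreover have "(\<Sum>y\<in>insert x ?P. (if y = x then t else 0) *\<^sub>R f y) = t *\<^sub>R f x"
    using assms by (subst sum.mono_neutral_cong_right[of _ "{x}" _ "\<lambda>y. t *\<^sub>R f y"]) auto
  ultimately show ?thesis
    by (simp add: mix_design_def scaleR_add_left sum.distrib scaleR_sum_right)
qed

lemma approx_design_on_mix_design:
  assumes "approx_design_on X \<xi>" "x \<in> X" "0 \<le> t" "t \<le> 1"
  shows "approx_design_on X (mix_design t x \<xi>)"
  using assms sum_mix_design[of \<xi> t x "\<lambda>_. 1::real"]
  unfolding approx_design_on_def by (auto simp: mix_design_def)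

lemma info_mat_mix_design:
  assumes "finite (design_points \<xi>)"
  shows "info_mat \<M> i (mix_design t x \<xi>) =
    (1 - t) *\<^sub>R info_mat \<M> i \<xi> + t *\<^sub>R (transpose (std_regr_mat \<M> i x) ** std_regr_mat \<M> i x)"
  unfolding info_mat_def by (rule sum_mix_design[OF assms])

text \<open>Designs enter only through their information matrices. Each of the three nested
  inversions is continuous at a positive definite limit.\<close>

lemma tendsto_sensitivity_mat:
  assumes "valid_model \<M>" "admissible_designs \<M> \<xi>" "i \<in> groups \<M>"
    and lim: "\<And>r. r \<in> groups \<M> \<Longrightarrow>
      ((\<lambda>t. info_mat \<M> r (\<eta> t r)) \<longlongrightarrow> info_mat \<M> r (\<xi> r)) F"
  shows "((\<lambda>t. sensitivity_mat \<M> V (\<eta> t) i) \<longlongrightarrow> sensitivity_mat \<M> V \<xi> i) F"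
proof -
  have info: "((\<lambda>t. matrix_inv (info_mat \<M> r (\<eta> t r))) \<longlongrightarrow> matrix_inv (info_mat \<M> r (\<xi> r))) F"
    if "r \<in> groups \<M>" for r
    using that assms by (intro tendsto_matrix_inv lim pos_def_invertible pos_def_info_mat)
  have group: "((\<lambda>t. group_info \<M> (\<eta> t) r) \<longlongrightarrow> group_info \<M> \<xi> r) F" if "r \<in> groups \<M>" for r
    unfolding group_info_def using that assms
    by (intro tendsto_matrix_inv tendsto_add info tendsto_const pos_def_invertible
        pos_def_group_info_inverse)
  have "((\<lambda>t. estimator_cov \<M> (\<eta> t)) \<longlongrightarrow> estimator_cov \<M> \<xi>) F"
    unfolding estimator_cov_def using assms
    by (intro tendsto_matrix_inv tendsto_sum tendsto_scaleR tendsto_const group pos_def_invertible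
        pos_def_total_info)
  then show ?thesis
    unfolding sensitivity_mat_def Let_def using assms(3)
    by (intro matrix_mult.tendsto tendsto_const info group)
qed

section \<open>Necessity: moving mass to a single point\<close>

lemma L_optimal_imp_sensitivity_le:
  fixes L :: "real^'p^'q::finite" and \<M> :: "('x, 'p::finite, 'l::finite) rcr_model"
  assumes model: "valid_model \<M>" and V: "V = transpose L ** L" and opt: "L_optimal \<M> V \<xi>"
    and i: "i \<in> groups \<M>" and x: "x \<in> region \<M> i"
  shows "trace (sensitivity_mat \<M> V \<xi> i ** (transpose (std_regr_mat \<M> i x) ** std_regr_mat \<M> i x))
    \<le> trace (sensitivity_mat \<M> V \<xi> i ** info_mat \<M> i (\<xi> i))"
proof -
  have adm: "admissible_designs \<M> \<xi>" using opt by (simp add: L_optimal_def)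
  then have fin: "finite (design_points (\<xi> i))"
    using i by (simp add: admissible_designs_def approx_design_on_def)
  let ?M = "info_mat \<M> i (\<xi> i)"
  let ?H = "transpose (std_regr_mat \<M> i x) ** std_regr_mat \<M> i x"
  define \<eta> where "\<eta> t = \<xi>(i := mix_design t x (\<xi> i))" for t
  have info: "info_mat \<M> r (\<eta> t r) = (if r = i then ?M + t *\<^sub>R (?H - ?M) else info_mat \<M> r (\<xi> r))"
    for r t
    by (simp add: \<eta>_def info_mat_mix_design[OF fin] algebra_simps)
  have adm': "admissible_designs \<M> (\<eta> t)" if t: "0 < t" "t < 1" for t
    unfolding admissible_designs_def
  proof
    fix r assume r: "r \<in> groups \<M>"
    show "approx_design_on (region \<M> r) (\<eta> t r) \<and> invertible (info_mat \<M> r (\<eta> t r))"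
    proof (cases "r = i")
      case True
      \<comment> \<open>\<open>?H\<close> may be singular, so definiteness comes from the first
        summand, by \<open>t < 1\<close>.\<close>
      have "pos_def_mat ((1 - t) *\<^sub>R ?M + t *\<^sub>R ?H)"
        using t i adm
        by (intro pos_def_add pos_def_scaleR pos_semidef_scaleR pos_semidef_gram pos_def_info_mat) auto
      then have "invertible (info_mat \<M> r (\<eta> t r))"
        using True by (simp add: \<eta>_def info_mat_mix_design[OF fin] pos_def_invertible)
      moreover have "approx_design_on (region \<M> r) (\<eta> t r)"
        using True t adm i x by (auto simp: \<eta>_def admissible_designs_def intro!: approx_design_on_mix_design)
      ultimately show ?thesis by blast
    next
      case False
      then show ?thesis using adm r by (simp add: \<eta>_def admissible_designs_def)
    qed
  qed
  have le: "trace (sensitivity_mat \<M> V (\<eta> t) i ** (?H - ?M)) \<le> 0" if t: "0 < t" "t < 1" for t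
  proof -
    define c where "c r = real (group_size \<M> r) * real (num_obs \<M> r)" for r
    have "(\<Sum>r\<in>groups \<M>. c r *
        trace (sensitivity_mat \<M> V (\<eta> t) r ** (info_mat \<M> r (\<eta> t r) - info_mat \<M> r (\<xi> r)))) \<le> 0"
      \<comment> \<open>The tangent point is the perturbed design and the bound is evaluated at
        \<xi>; optimality of \<xi> makes the correction nonpositive. Only group i contributes, with
        the positive factor \<open>c i * t\<close>.\<close>
      using L_criterion_tangent[OF model adm'[OF t] adm V] opt adm'[OF t]
      unfolding L_optimal_def c_def by fastforce
    also have "(\<Sum>r\<in>groups \<M>. c r *
        trace (sensitivity_mat \<M> V (\<eta> t) r ** (info_mat \<M> r (\<eta> t r) - info_mat \<M> r (\<xi> r))))
      = (\<Sum>r\<in>groups \<M>. if r = i then c i * (t * trace (sensitivity_mat \<M> V (\<eta> t) i ** (?H - ?M))) else 0)"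
      by (intro sum.cong) (auto simp: info matrix_mult.scaleR_right matrix_mult.zero_right
          trace_scaleR linear_0[OF linear_trace])
    also have "\<dots> = c i * (t * trace (sensitivity_mat \<M> V (\<eta> t) i ** (?H - ?M)))"
      using i by simp
    finally show ?thesis
      using group_weight_pos[OF model i] t by (auto simp: c_def mult_le_0_iff)
  qed
  have "((\<lambda>t. info_mat \<M> r (\<eta> t r)) \<longlongrightarrow> info_mat \<M> r (\<xi> r)) (at_right 0)" for r
    unfolding info by (cases "r = i") (auto intro!: tendsto_eq_intros)
  then have "((\<lambda>t. sensitivity_mat \<M> V (\<eta> t) i) \<longlongrightarrow> sensitivity_mat \<M> V \<xi> i) (at_right 0)"
    by (intro tendsto_sensitivity_mat model adm i)
  then have "((\<lambda>t. trace (sensitivity_mat \<M> V (\<eta> t) i ** (?H - ?M)))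
      \<longlongrightarrow> trace (sensitivity_mat \<M> V \<xi> i ** (?H - ?M))) (at_right 0)"
    by (intro bounded_linear.tendsto[OF linear_conv_bounded_linear[THEN iffD1, OF linear_trace]]
        matrix_mult.tendsto tendsto_const)
  moreover have "\<forall>\<^sub>F t in at_right 0. trace (sensitivity_mat \<M> V (\<eta> t) i ** (?H - ?M)) \<le> 0"
    by (rule eventually_mono[OF eventually_at_right_real[OF zero_less_one]]) (use le in auto)
  ultimately have "trace (sensitivity_mat \<M> V \<xi> i ** (?H - ?M)) \<le> 0"
    by (rule tendsto_upperbound) simp
  then show ?thesis by (simp add: matrix_mult.diff_right trace_sub)
qed

section \<open>Averaging the pointwise inequality over a design\<close>

lemma trace_info_mat_le:
  assumes "approx_design_on (region \<M> i) \<xi>"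
    and "\<And>x. x \<in> region \<M> i \<Longrightarrow>
      trace (std_regr_mat \<M> i x ** B ** transpose (std_regr_mat \<M> i x)) \<le> b"
  shows "trace (B ** info_mat \<M> i \<xi>) \<le> b"
proof -
  have "trace (B ** info_mat \<M> i \<xi>) \<le> (\<Sum>x\<in>design_points \<xi>. design_weight \<xi> x * b)"
    unfolding trace_mult_info_mat using assms
    by (intro sum_mono mult_left_mono assms(2)) (auto simp: approx_design_on_def)
  also have "\<dots> = b"
    using assms(1) by (simp add: approx_design_on_def flip: sum_distrib_right)
  finally show ?thesis .
qed

text \<open>The weighted gaps are nonnegative and sum to zero, because the average of the left-hand
  sides is the bound itself. Hence each vanishes, and a positive weight can be cancelled.\<close>

lemma trace_info_mat_eq_imp_support_eq:
  assumes \<xi>: "approx_design_on (region \<M> i) \<xi>"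
    and le: "\<And>x. x \<in> region \<M> i \<Longrightarrow>
      trace (std_regr_mat \<M> i x ** B ** transpose (std_regr_mat \<M> i x)) \<le> trace (B ** info_mat \<M> i \<xi>)"
    and x: "x \<in> design_support \<xi>"
  shows "trace (std_regr_mat \<M> i x ** B ** transpose (std_regr_mat \<M> i x)) = trace (B ** info_mat \<M> i \<xi>)"
proof -
  define f where "f y = trace (std_regr_mat \<M> i y ** B ** transpose (std_regr_mat \<M> i y))" for y
  define b where "b = trace (B ** info_mat \<M> i \<xi>)"
  have nonneg: "0 \<le> design_weight \<xi> y * (b - f y)" if "y \<in> design_points \<xi>" for y
    using \<xi> le[of y] that by (auto simp: approx_design_on_def f_def b_def)
  have "(\<Sum>y\<in>design_points \<xi>. design_weight \<xi> y * (b - f y))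
      = (\<Sum>y\<in>design_points \<xi>. design_weight \<xi> y) * b - (\<Sum>y\<in>design_points \<xi>. design_weight \<xi> y * f y)"
    by (simp add: right_diff_distrib sum_subtractf sum_distrib_right)
  also have "\<dots> = 0"
    using \<xi> by (simp add: approx_design_on_def b_def f_def trace_mult_info_mat)
  finally have "design_weight \<xi> x * (b - f x) = 0"
    using \<xi> x nonneg by (subst (asm) sum_nonneg_eq_0_iff) (auto simp: approx_design_on_def design_support_def)
  then show ?thesis
    using x by (simp add: design_support_def f_def b_def)
qed


theorem theorem3:
  fixes \<M> :: "('x, 'p::finite, 'l::finite) rcr_model"
    and L :: "real^'p^'q::finite"
    and V :: "real^'p^'p"
    and \<xi> :: "nat \<Rightarrow> 'x design"
    and M A :: "nat \<Rightarrow> real^'p^'p"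
    and C :: "real^'p^'p"
    and G :: "nat \<Rightarrow> 'x \<Rightarrow> real^'p^'l"
  assumes "valid_model \<M>"
    and "V = transpose L ** L"
    and "admissible_designs \<M> \<xi>"
    and "M = (\<lambda>i. info_mat \<M> i (\<xi> i))"
    and "A = group_info \<M> \<xi>"
    and "C = estimator_cov \<M> \<xi>"
    and "G = std_regr_mat \<M>"
  shows "(L_optimal \<M> V \<xi> \<longleftrightarrow>
      (\<forall>i\<in>groups \<M>. \<forall>x\<in>region \<M> i.
        trace (G i x ** (matrix_inv (M i) ** A i ** C ** V ** C ** A i ** matrix_inv (M i))
                 ** transpose (G i x))
          \<le> trace (matrix_inv (M i) ** A i ** C ** V ** C ** A i)))
    \<and> (L_optimal \<M> V \<xi> \<longrightarrow>
      (\<forall>i\<in>groups \<M>. \<forall>x\<in>design_support (\<xi> i).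
        trace (G i x ** (matrix_inv (M i) ** A i ** C ** V ** C ** A i ** matrix_inv (M i))
                 ** transpose (G i x))
          = trace (matrix_inv (M i) ** A i ** C ** V ** C ** A i)))"
proof -
  have trace_gram: "trace (G i x ** B ** transpose (G i x)) = trace (B ** (transpose (G i x) ** G i x))"
    for i x B
    using trace_mul_sym[of "G i x" "B ** transpose (G i x)"] by (simp add: matrix_mul_assoc)
  have B: "matrix_inv (M i) ** A i ** C ** V ** C ** A i ** matrix_inv (M i) = sensitivity_mat \<M> V \<xi> i"
    for i
    by (simp add: sensitivity_mat_def Let_def assms)
  \<comment> \<open>Multiplying the sensitivity matrix by \<open>M i\<close> cancels its last
    factor; invertibility of \<open>M i\<close> is known for actual groups only.\<close>
  have BM: "trace (matrix_inv (M i) ** A i ** C ** V ** C ** A i)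
      = trace (sensitivity_mat \<M> V \<xi> i ** info_mat \<M> i (\<xi> i))" if "i \<in> groups \<M>" for i
  proof -
    have "matrix_inv (M i) ** M i = mat 1"
      using that assms by (intro matrix_inv_mult) (auto simp: admissible_designs_def)
    then show ?thesis
      by (simp add: B[symmetric] assms(4) flip: matrix_mul_assoc)
  qed
  have necessary: "trace (G i x ** sensitivity_mat \<M> V \<xi> i ** transpose (G i x))
      \<le> trace (sensitivity_mat \<M> V \<xi> i ** info_mat \<M> i (\<xi> i))"
    if "L_optimal \<M> V \<xi>" "i \<in> groups \<M>" "x \<in> region \<M> i" for i x
    using L_optimal_imp_sensitivity_le[OF assms(1,2) that] by (simp add: trace_gram flip: assms(7))
  have sufficient: "L_optimal \<M> V \<xi>"
    if *: "\<And>i x. i \<in> groups \<M> \<Longrightarrow> x \<in> region \<M> i \<Longrightarrow>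
      trace (G i x ** sensitivity_mat \<M> V \<xi> i ** transpose (G i x))
        \<le> trace (sensitivity_mat \<M> V \<xi> i ** info_mat \<M> i (\<xi> i))"
    unfolding L_optimal_def
  proof (intro conjI allI impI)
    fix \<eta> assume \<eta>: "admissible_designs \<M> \<eta>"
    \<comment> \<open>Here the tangent point is \<xi> and the competitor \<eta> is arbitrary, so no
      limit is required.\<close>
    have "0 \<le> (\<Sum>i\<in>groups \<M>. real (group_size \<M> i) * real (num_obs \<M> i) *
      trace (sensitivity_mat \<M> V \<xi> i ** (info_mat \<M> i (\<xi> i) - info_mat \<M> i (\<eta> i))))"
    proof (intro sum_nonneg mult_nonneg_nonneg)
      fix i assume i: "i \<in> groups \<M>"
      have "trace (sensitivity_mat \<M> V \<xi> i ** info_mat \<M> i (\<eta> i))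
          \<le> trace (sensitivity_mat \<M> V \<xi> i ** info_mat \<M> i (\<xi> i))"
        using \<eta> i * by (intro trace_info_mat_le) (auto simp: admissible_designs_def assms(7))
      then show "0 \<le> trace (sensitivity_mat \<M> V \<xi> i ** (info_mat \<M> i (\<xi> i) - info_mat \<M> i (\<eta> i)))"
        by (simp add: matrix_mult.diff_right trace_sub)
    qed simp_all
    then show "L_criterion \<M> V \<xi> \<le> L_criterion \<M> V \<eta>"
      using L_criterion_tangent[OF assms(1,3) \<eta> assms(2)] by linarith
  qed (rule assms(3))
  have equality: "trace (G i x ** sensitivity_mat \<M> V \<xi> i ** transpose (G i x))
      = trace (sensitivity_mat \<M> V \<xi> i ** info_mat \<M> i (\<xi> i))"
    if "L_optimal \<M> V \<xi>" "i \<in> groups \<M>" "x \<in> design_support (\<xi> i)" for i x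
    using that assms(3) necessary unfolding assms(7)
    by (intro trace_info_mat_eq_imp_support_eq) (auto simp: admissible_designs_def)
  show ?thesis
    \<comment> \<open>\<open>ball_cong\<close> supplies the group membership on which
      \<open>BM\<close> is conditional.\<close>
    unfolding B by (simp only: BM cong: ball_cong) (use necessary sufficient equality in blast)
qed

end
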